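(* Let $(X,X_+,\mathcal{K},f)$ be an abstract state space, let $T:X\to X$ be a Markov operator and let $P:X\to X$ be a bounded linear projection ($P^2=P$). If $T$ is uniformly $P$-ergodic, i.e. $\lim_{n\to\infty}\|T^n-P\|=0$, then, with $$\beta^*=\sup\{|\lambda| : \lambda\in\sigma(T),\ \lambda\neq 1\},$$ there is a real sequence $(\alpha_n)_{n\ge1}$ with $\alpha_n\to0$ as $n\to\infty$ such that $\|T^n-P\|=(\beta^*+\alpha_n)^n$ for all $n\ge 1$.
   Context: Abstract state space: let $X\neq\{0\}$ be a real ordered vector space with cone $X_+=\{x\in X: x\ge 0\}$ which is generating ($X=X_+-X_+$), let $f$ be a strictly positive linear functional on $X$ ($f(x)>0$ for $x\ge 0$, $x\ne 0$), and let $\mathcal{K}=\{x\in X_+: f(x)=1\}$. Let $U$ be the convex hull of $\mathcal{K}\cup(-\mathcal{K})$ and $\|x\|=\inf\{\lambda\ge 0: x\in\lambda U\}$. $(X,X_+,\mathcal{K},f)$ is an abstract state space if this seminorm is a norm, $X$ is complete for it, and $X_+$ is closed. A Markov operator on $X$ is a linear operator $T:X\to X$ that is positive ($Tx\ge0$ for $x\ge0$) and satisfies $T(\mathcal{K})\subset\mathcal{K}$. Complexification: spectral notions are taken over $\mathbb{C}$. That is, $X$ is replaced by $\tilde X=X+iX$ with norm $\|x+iy\|_\infty=\sup_{0\le t\le 2\pi}\|x\cos t-y\sin t\|$, and a bounded operator $T$ on $X$ by its extension $x+iy\mapsto Tx+iTy$ (which has the same norm). $\sigma(T)$ is the set of $\lambda\in\mathbb{C}$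 such that $\lambda I-T$ does not have a continuous inverse. In the degenerate case $P=I$ (so $T=I$), the supremum of the empty set is taken to be $0$. *)

theory Defs
  imports "HOL-Analysis.Analysis"
begin

section \<open>Abstract state spaces and Markov operators\<close>

definition base :: "('a::ordered_real_vector \<Rightarrow> real) \<Rightarrow> 'a set" where
  "base f = {x. 0 \<le> x \<and> f x = 1}"

definition base_norm :: "('a::ordered_real_vector \<Rightarrow> real) \<Rightarrow> 'a \<Rightarrow> real" where
  "base_norm f x =
    Inf {c. 0 \<le> c \<and> x \<in> (\<lambda>u. c *\<^sub>R u) ` (convex hull (base f \<union> uminus ` base f))}"

text \<open>
  That the base seminorm is a norm for which the space is complete is expressed by requiring it
  to be the norm of the Banach space \<^typ>\<open>'a\<close>.
\<close>

locale abstract_state_space =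
  fixes f :: "'a::{ordered_real_vector, banach} \<Rightarrow> real"
  assumes nontrivial: "\<exists>x::'a. x \<noteq> 0"
    and generating: "\<forall>x::'a. \<exists>y z. 0 \<le> y \<and> 0 \<le> z \<and> x = y - z"
    and linear_functional: "linear f"
    and strictly_positive: "\<forall>x. 0 \<le> x \<longrightarrow> x \<noteq> 0 \<longrightarrow> 0 < f x"
    and norm_eq_base_norm: "\<forall>x. norm x = base_norm f x"
    and closed_cone: "closed {x::'a. 0 \<le> x}"

definition markov_operator ::
    "('a::ordered_real_vector \<Rightarrow> real) \<Rightarrow> ('a \<Rightarrow> 'a) \<Rightarrow> bool" where
  "markov_operator f T \<longleftrightarrow>
    linear T \<and> (\<forall>x. 0 \<le> x \<longrightarrow> 0 \<le> T x) \<and> T ` base f \<subseteq> base f"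

definition uniformly_ergodic ::
    "('a::real_normed_vector \<Rightarrow> 'a) \<Rightarrow> ('a \<Rightarrow> 'a) \<Rightarrow> bool" where
  "uniformly_ergodic T P \<longleftrightarrow> (\<lambda>n. onorm (\<lambda>x. (T ^^ n) x - P x)) \<longlonglongrightarrow> 0"


section \<open>Complexification\<close>

text \<open>\<open>Complexify x y\<close> stands for \<open>x + i y\<close>.\<close>

datatype 'a complexification = Complexify (re_part: 'a) (im_part: 'a)

instantiation complexification :: (real_normed_vector) real_normed_vector
begin

definition zero_complexification :: "'a complexification" where
  "0 = Complexify 0 0"

definition plus_complexification ::
    "'a complexification \<Rightarrow> 'a complexification \<Rightarrow> 'a complexification" where
  "z + w = Complexify (re_part z + re_part w) (im_part z + im_part w)"

definition minus_complexification ::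
    "'a complexification \<Rightarrow> 'a complexification \<Rightarrow> 'a complexification" where
  "z - w = Complexify (re_part z - re_part w) (im_part z - im_part w)"

definition uminus_complexification :: "'a complexification \<Rightarrow> 'a complexification" where
  "- z = Complexify (- re_part z) (- im_part z)"

definition scaleR_complexification ::
    "real \<Rightarrow> 'a complexification \<Rightarrow> 'a complexification" where
  "c *\<^sub>R z = Complexify (c *\<^sub>R re_part z) (c *\<^sub>R im_part z)"

definition norm_complexification :: "'a complexification \<Rightarrow> real" where
  "norm z = (SUP t\<in>{0..2 * pi}. norm (cos t *\<^sub>R re_part z - sin t *\<^sub>R im_part z))"

definition sgn_complexification :: "'a complexification \<Rightarrow> 'a complexification" where
  "sgn z = inverse (norm z) *\<^sub>R (z :: 'a complexification)"

definition dist_complexification ::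
    "'a complexification \<Rightarrow> 'a complexification \<Rightarrow> real" where
  "dist z w = norm (z - (w :: 'a complexification))"

definition uniformity_complexification ::
    "('a complexification \<times> 'a complexification) filter" where
  "uniformity = (INF e\<in>{0<..}. principal {(z, w :: 'a complexification). dist z w < e})"

definition open_complexification :: "'a complexification set \<Rightarrow> bool" where
  "open U \<longleftrightarrow>
    (\<forall>z\<in>U. \<forall>\<^sub>F (z', w) in uniformity. z' = z \<longrightarrow> (w :: 'a complexification) \<in> U)"

instance
proof
  note defs = zero_complexification_def plus_complexification_def minus_complexification_def
    uminus_complexification_def scaleR_complexification_def
  fix z w v :: "'a complexification" and a b :: real and U :: "'a complexification set"
  let ?g = "\<lambda>z t. norm (cos t *\<^sub>R re_part z - sin t *\<^sub>R im_part (z :: 'a complexification))"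
  have le: "?g z t \<le> norm (re_part z) + norm (im_part z)" for z t
  proof -
    have "?g z t \<le> norm (cos t *\<^sub>R re_part z) + norm (sin t *\<^sub>R im_part z)"
      by (rule norm_triangle_ineq4)
    also have "\<dots> \<le> norm (re_part z) + norm (im_part z)"
      by (simp add: add_mono mult_left_le_one_le)
    finally show ?thesis .
  qed
  have upper: "?g z t \<le> norm z" if "t \<in> {0..2 * pi}" for z t
    unfolding norm_complexification_def
    using that le by (intro cSUP_upper bdd_aboveI2)
  have least: "norm z \<le> c" if "\<And>t. t \<in> {0..2 * pi} \<Longrightarrow> ?g z t \<le> c" for z c
    unfolding norm_complexification_def
    by (intro cSUP_least that) auto
  have scale_le: "norm (a *\<^sub>R z) \<le> \<bar>a\<bar> * norm z" for a and z :: "'a complexification"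
  proof (rule least)
    fix t :: real
    assume t: "t \<in> {0..2 * pi}"
    have "?g (a *\<^sub>R z) t = norm (a *\<^sub>R (cos t *\<^sub>R re_part z - sin t *\<^sub>R im_part z))"
      by (simp add: defs scaleR_diff_right mult.commute)
    also have "\<dots> = \<bar>a\<bar> * ?g z t"
      by (rule norm_scaleR)
    also have "\<dots> \<le> \<bar>a\<bar> * norm z"
      by (intro mult_left_mono upper t) simp
    finally show "?g (a *\<^sub>R z) t \<le> \<bar>a\<bar> * norm z" .
  qed
  show "z + w + v = z + (w + v)" "z + w = w + z" "0 + z = z" "- z + z = 0" "z - w = z + - w"
    "a *\<^sub>R (z + w) = a *\<^sub>R z + a *\<^sub>R w" "(a + b) *\<^sub>R z = a *\<^sub>R z + b *\<^sub>R z"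
    "a *\<^sub>R b *\<^sub>R z = (a * b) *\<^sub>R z" "1 *\<^sub>R z = z"
    by (simp_all add: defs algebra_simps)
  show "dist z w = norm (z - w)"
    by (rule dist_complexification_def)
  show "sgn z = inverse (norm z) *\<^sub>R z"
    by (rule sgn_complexification_def)
  show "uniformity = (INF e\<in>{0<..}. principal {(z, w :: 'a complexification). dist z w < e})"
    by (rule uniformity_complexification_def)
  show "open U \<longleftrightarrow> (\<forall>z\<in>U. \<forall>\<^sub>F (z', w) in uniformity. z' = z \<longrightarrow> w \<in> U)"
    by (rule open_complexification_def)
  show "norm z = 0 \<longleftrightarrow> z = 0"
  proof
    assume "norm z = 0"
    then have "re_part z = 0" "im_part z = 0"
      using upper[of 0 z] upper[of "pi / 2" z] by simp_all
    then show "z = 0"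
      by (cases z) (simp add: defs)
  next
    assume "z = 0"
    then show "norm z = 0"
      by (simp add: norm_complexification_def defs)
  qed
  show "norm (z + w) \<le> norm z + norm w"
  proof (rule least)
    fix t :: real
    assume t: "t \<in> {0..2 * pi}"
    have "?g (z + w) t = norm ((cos t *\<^sub>R re_part z - sin t *\<^sub>R im_part z)
        + (cos t *\<^sub>R re_part w - sin t *\<^sub>R im_part w))"
      by (simp add: defs algebra_simps)
    also have "\<dots> \<le> ?g z t + ?g w t"
      by (rule norm_triangle_ineq)
    also have "\<dots> \<le> norm z + norm w"
      by (intro add_mono upper t)
    finally show "?g (z + w) t \<le> norm z + norm w" .
  qed
  show "norm (a *\<^sub>R z) = \<bar>a\<bar> * norm z"
  proof (cases "a = 0")
    case True
    then show ?thesis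
      by (simp add: norm_complexification_def defs)
  next
    case False
    have "inverse a *\<^sub>R a *\<^sub>R z = z"
      using False by (cases z) (simp add: defs)
    then have "norm z \<le> \<bar>inverse a\<bar> * norm (a *\<^sub>R z)"
      using scale_le[of "inverse a" "a *\<^sub>R z"] by simp
    then have "\<bar>a\<bar> * norm z \<le> norm (a *\<^sub>R z)"
      using False by (simp add: field_simps)
    with scale_le[of a z] show ?thesis
      by simp
  qed
qed

end

definition scaleC ::
    "complex \<Rightarrow> 'a::real_vector complexification \<Rightarrow> 'a complexification" where
  "scaleC c z = Complexify (Re c *\<^sub>R re_part z - Im c *\<^sub>R im_part z)
                           (Re c *\<^sub>R im_part z + Im c *\<^sub>R re_part z)"

definition complexify_op ::
    "('a \<Rightarrow> 'a) \<Rightarrow> 'a complexification \<Rightarrow> 'a complexification" where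
  "complexify_op T z = Complexify (T (re_part z)) (T (im_part z))"


section \<open>Spectrum\<close>

definition has_continuous_inverse ::
    "('b::topological_space \<Rightarrow> 'b) \<Rightarrow> bool" where
  "has_continuous_inverse A \<longleftrightarrow> bij A \<and> continuous_on UNIV (inv A)"

definition spectrum :: "('a::real_normed_vector \<Rightarrow> 'a) \<Rightarrow> complex set" where
  "spectrum T = {c. \<not> has_continuous_inverse (\<lambda>z. scaleC c z - complexify_op T z)}"

text \<open>
  The supremum of the empty set, which occurs for the identity operator, is taken to be \<open>0\<close>.
\<close>

definition beta_star :: "('a::real_normed_vector \<Rightarrow> 'a) \<Rightarrow> real" where
  "beta_star T =
    (let S = cmod ` (spectrum T - {1}) in if S = {} then 0 else Sup S)"

end

(*
  The bounded operators on the complexification form a normed algebra containing the complex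
  scalars.  With Q = T - P one has Q^n = T^n - P for n >= 1, so the claim is that the n-th root of
  the norm of Q^n tends to beta*.  Since PQ = QP = 0, the factorisation
  c - T = (c - Q)(1 - P/c) shows that T and Q have the same spectrum away from 0 and 1, and 1 is
  not in the spectrum of Q because some power of Q is a strict contraction.

  It remains to prove Gelfand's formula for Q.  Following Rickart, this avoids vector-valued
  holomorphic functions: the average of (1 - w t Q)^-1 over the n-th roots of unity w equals
  (1 - (tQ)^n)^-1.  The resolvent is uniformly continuous on any closed disc on which it exists,
  hence (tQ)^n -> 0 for all t < tau forces (tau Q)^n to have norm below 1 for some n; so the set
  of t with (tQ)^n -> 0 can only stop at the reciprocal of the modulus of a spectral value.
*)
theory Submission imports Defs begin

section \<open>Gelfand's formula\<close>

definition two_sided_unit :: "'a::monoid_mult \<Rightarrow> bool" where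
  "two_sided_unit a \<longleftrightarrow> (\<exists>b. b * a = 1 \<and> a * b = 1)"

lemma two_sided_unitI: "b * a = 1 \<Longrightarrow> a * b = 1 \<Longrightarrow> two_sided_unit a"
  by (auto simp: two_sided_unit_def)

lemma two_sided_unit_1 [simp]: "two_sided_unit 1"
  by (rule two_sided_unitI[of 1]) simp_all

lemma two_sided_unit_mult:
  assumes "two_sided_unit a" "two_sided_unit b"
  shows "two_sided_unit (a * b)"
proof -
  obtain c d where "c * a = 1" "a * c = 1" "d * b = 1" "b * d = 1"
    using assms by (auto simp: two_sided_unit_def)
  then have "(d * c) * (a * b) = 1" "(a * b) * (d * c) = 1"
    by (metis mult.assoc mult.left_neutral)+
  then show ?thesis
    by (rule two_sided_unitI)
qed

lemma two_sided_unit_mult_right_iff: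
  assumes "two_sided_unit b"
  shows "two_sided_unit (a * b) \<longleftrightarrow> two_sided_unit a"
proof
  obtain c where c: "c * b = 1" "b * c = 1"
    using assms by (auto simp: two_sided_unit_def)
  assume "two_sided_unit (a * b)"
  moreover have "two_sided_unit c"
    using c by (intro two_sided_unitI[of b])
  ultimately have "two_sided_unit (a * b * c)"
    by (rule two_sided_unit_mult)
  then show "two_sided_unit a"
    by (simp add: mult.assoc c)
qed (intro two_sided_unit_mult assms)

text \<open>Telescoping. The identity serves twice: for the Neumann series, and with
  \<open>y\<close> a rotated multiple of the element in the root-of-unity average.\<close>

lemma one_minus_mult_sum_power:
  fixes y :: "'a::{ring, monoid_mult}"
  shows "(1 - y) * (\<Sum>j<n. y ^ j) = 1 - y ^ n"
    and "(\<Sum>j<n. y ^ j) * (1 - y) = 1 - y ^ n"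
proof -
  show "(1 - y) * (\<Sum>j<n. y ^ j) = 1 - y ^ n"
    by (induction n) (simp_all add: distrib_left, simp add: left_diff_distrib)
  show "(\<Sum>j<n. y ^ j) * (1 - y) = 1 - y ^ n"
    by (induction n) (simp_all add: distrib_right, simp add: right_diff_distrib power_commutes)
qed

text \<open>Splitting off blocks of length \<open>n\<close> from the exponent costs a factor of at
  most \<open>\<kappa> ^ n\<close> per block, and the remaining exponent below \<open>n\<close>
  takes only finitely many values.\<close>

lemma norm_power_le_geometric:
  fixes y :: "'a::{real_normed_algebra, monoid_mult}"
  assumes "norm (y ^ n) < 1" "n \<ge> 1"
  obtains c \<kappa> where "0 < \<kappa>" "\<kappa> < 1" "\<And>m. norm (y ^ m) \<le> c * \<kappa> ^ m"
proof -
  \<comment> \<open>The lower bound 1/2 keeps \<open>\<kappa>\<close> positive even if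
    \<open>y ^ n = 0\<close>, so that dividing by its powers is harmless.\<close>
  define \<kappa> where "\<kappa> = root n (max (norm (y ^ n)) (1 / 2))"
  have \<kappa>: "0 < \<kappa>" "\<kappa> < 1" "norm (y ^ n) \<le> \<kappa> ^ n"
    using assms by (simp_all add: \<kappa>_def real_root_pow_pos2 le_max_iff_disj)
  \<comment> \<open>One summand for each possible remainder: each start value \<open>m < n\<close>
    is covered by its own term.\<close>
  define c where "c = (\<Sum>r<n. norm (y ^ r) / \<kappa> ^ r)"
  have c: "c \<ge> 0"
    using \<kappa> by (auto simp: c_def intro!: sum_nonneg)
  have "norm (y ^ m) \<le> c * \<kappa> ^ m" for m
  proof (induction m rule: less_induct)
    case (less m)
    show ?case
    proof (cases "m < n")
      case True
      then have "norm (y ^ m) / \<kappa> ^ m \<le> c"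
        unfolding c_def using \<kappa> by (intro member_le_sum) auto
      then show ?thesis
        using \<kappa> by (simp add: field_simps)
    next
      case False
      then have m: "m = n + (m - n)" by simp
      have "norm (y ^ m) \<le> norm (y ^ n) * norm (y ^ (m - n))"
        by (subst m, subst power_add) (rule norm_mult_ineq)
      also have "\<dots> \<le> \<kappa> ^ n * (c * \<kappa> ^ (m - n))"
        using \<kappa> c False assms less[of "m - n"] by (intro mult_mono) auto
      also have "\<dots> = c * \<kappa> ^ m"
        using m by (metis mult.left_commute power_add)
      finally show ?thesis .
    qed
  qed
  with \<kappa> that show ?thesis by blast
qed

lemma summable_norm_power:
  fixes y :: "'a::{real_normed_algebra, monoid_mult}"
  assumes "norm (y ^ n) < 1" "n \<ge> 1"
  shows "summable (\<lambda>m. norm (y ^ m))"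
proof -
  obtain c \<kappa> where *: "0 < \<kappa>" "\<kappa> < 1" "\<And>m. norm (y ^ m) \<le> c * \<kappa> ^ m"
    using norm_power_le_geometric[OF assms] by blast
  have "summable (\<lambda>m. c * \<kappa> ^ m)"
    using * by (intro summable_mult summable_geometric) simp
  then show ?thesis
    by (rule summable_comparison_test') (use * in auto)
qed

text \<open>The Neumann series converges absolutely as soon as some power of \<open>y\<close> is a
  strict contraction; \<open>y\<close> itself may have a large norm. Passing to the limit in the
  telescoping identity gives an inverse on both sides.\<close>

lemma two_sided_unit_one_minus:
  fixes y :: "'a::{real_normed_algebra, monoid_mult, banach}"
  assumes "norm (y ^ n) < 1" "n \<ge> 1"
  shows "two_sided_unit (1 - y)"
proof -
  have "summable (\<lambda>m. y ^ m)"
    by (rule summable_norm_cancel[OF summable_norm_power[OF assms]])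
  then have lim: "(\<lambda>k. \<Sum>j<k. y ^ j) \<longlonglongrightarrow> (\<Sum>m. y ^ m)" and 0: "(\<lambda>m. y ^ m) \<longlonglongrightarrow> 0"
    by (simp_all add: summable_LIMSEQ summable_LIMSEQ_zero)
  have 1: "(\<lambda>k. 1 - y ^ k) \<longlonglongrightarrow> 1"
    using tendsto_diff[OF tendsto_const 0] by simp
  have "(1 - y) * (\<Sum>m. y ^ m) = 1"
    using tendsto_mult_left[OF lim, of "1 - y"] 1
    by (auto simp: one_minus_mult_sum_power intro: LIMSEQ_unique)
  moreover have "(\<Sum>m. y ^ m) * (1 - y) = 1"
    using tendsto_mult_right[OF lim, of "1 - y"] 1
    by (auto simp: one_minus_mult_sum_power intro: LIMSEQ_unique)
  ultimately show ?thesis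
    by (intro two_sided_unitI)
qed

text \<open>The resolvent identity h w - h v = h w (g v - g w) h v controls the increment of
  \<open>h\<close> by that of \<open>g\<close>. It still contains the unknown size of
  \<open>h w\<close>, which is absorbed near \<open>v\<close>.\<close>

lemma continuous_on_two_sided_inverse:
  fixes g h :: "'b::topological_space \<Rightarrow> 'a::{real_normed_algebra, monoid_mult}"
  assumes g: "continuous_on S g"
    and left: "\<And>w. w \<in> S \<Longrightarrow> h w * g w = 1"
    and right: "\<And>w. w \<in> S \<Longrightarrow> g w * h w = 1"
  shows "continuous_on S h"
  unfolding continuous_on_def
proof
  fix v assume v: "v \<in> S"
  define d where "d w = norm (g v - g w)" for w
  define K where "K = norm (h v)"
  have "(g \<longlongrightarrow> g v) (at v within S)"
    using g v by (auto simp: continuous_on_def)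
  then have d: "(d \<longlongrightarrow> 0) (at v within S)"
    unfolding d_def by (auto intro!: tendsto_eq_intros)
  have "((\<lambda>w. d w * K) \<longlongrightarrow> 0) (at v within S)"
    using tendsto_mult_right[OF d, of K] by simp
  then have "\<forall>\<^sub>F w in at v within S. d w * K < 1 / 2"
    by (rule order_tendstoD) simp
  moreover have "\<forall>\<^sub>F w in at v within S. w \<in> S"
    by (simp add: eventually_at_filter)
  ultimately have "\<forall>\<^sub>F w in at v within S. norm (h w - h v) \<le> d w * (2 * K\<^sup>2)"
  proof eventually_elim
    case (elim w)
    have "h w - h v = h w * (g v - g w) * h v"
      using left[OF elim(2)] right[OF v] by (simp add: right_diff_distrib left_diff_distrib mult.assoc)
    also have "norm \<dots> \<le> norm (h w) * d w * K"
      unfolding d_def K_def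
      by (intro norm_mult_ineq[THEN order_trans] mult_right_mono norm_mult_ineq) simp
    \<comment> \<open>Comparing \<open>h w\<close> with \<open>h v\<close> brings the increment back
      on the right. Its coefficient \<open>d w * K\<close> is below 1/2, so it can be moved to the
      left, which accounts for the factor 2 in the bound.\<close>
    also have "\<dots> \<le> (norm (h w - h v) + K) * (d w * K)"
      unfolding mult.assoc using norm_triangle_sub[of "h w" "h v"]
      by (intro mult_right_mono) (auto simp: K_def d_def)
    also have "\<dots> \<le> norm (h w - h v) * (1 / 2) + d w * K\<^sup>2"
      using mult_left_mono[of "d w * K" "1 / 2" "norm (h w - h v)"] elim(1)
      by (simp add: algebra_simps power2_eq_square)
    finally show ?case by simp
  qed
  moreover have "((\<lambda>w. d w * (2 * K\<^sup>2)) \<longlongrightarrow> 0) (at v within S)"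
    using tendsto_mult_right[OF d, of "2 * K\<^sup>2"] by simp
  ultimately have "((\<lambda>w. h w - h v) \<longlongrightarrow> 0) (at v within S)"
    by (rule Lim_null_comparison)
  then show "(h \<longlongrightarrow> h v) (at v within S)"
    by (simp add: LIM_zero_iff)
qed

section \<open>Sums of powers of roots of unity\<close>

lemma cis_root_of_unity:
  assumes "n \<ge> 1"
  shows "cis (2 * pi * real k / real n) ^ n = 1"
proof -
  have "real n * (2 * pi * real k / real n) = 2 * pi * real k"
    using assms by simp
  then show ?thesis
    by (simp only: Complex.DeMoivre) (simp add: cis_multiple_2pi)
qed

lemma sum_powers_root_of_unity:
  assumes "j < n"
  shows "(\<Sum>k<n. cis (2 * pi * real k / real n) ^ j) = (if j = 0 then of_nat n else 0)"
proof (cases "j = 0")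
  case False
  define \<omega> where "\<omega> = cis (2 * pi * real j / real n)"
  \<comment> \<open>The n roots of unity are pairwise distinct, so the one with index
    \<open>j\<close> differs from the one with index 0.\<close>
  have "\<omega> \<noteq> 1"
    using bij_betw_imp_inj_on[OF Complex.bij_betw_roots_unity[of n]] assms False
      inj_onD[of "\<lambda>k. cis (2 * pi * real k / real n)" "{..<n}" j 0] by (auto simp: \<omega>_def)
  moreover have "\<omega> ^ n = 1"
    using assms by (simp add: \<omega>_def cis_root_of_unity)
  ultimately have "(\<Sum>k<n. \<omega> ^ k) = 0"
    by (simp add: geometric_sum)
  \<comment> \<open>Exchanging the roles of \<open>j\<close> and \<open>k\<close> turns the sum of
    j-th powers into a geometric sum with ratio \<open>\<omega>\<close>.\<close>
  moreover have "cis (2 * pi * real k / real n) ^ j = \<omega> ^ k" for k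
    by (simp add: \<omega>_def Complex.DeMoivre mult_ac)
  ultimately show ?thesis
    using False by simp
qed simp

text \<open>A complex Banach algebra seen through the real algebra classes: \<open>\<phi>\<close>
  stands for multiplication of the unit by a complex scalar, and its values have to commute with the
  one element \<open>x\<close> under study. It is bounded rather than isometric, so estimates carry
  a constant.\<close>

locale complex_scalars =
  fixes \<phi> :: "complex \<Rightarrow> 'a::{real_normed_algebra, monoid_mult, banach}" and x :: 'a
  assumes bounded_linear_\<phi>: "bounded_linear \<phi>"
    and \<phi>_mult: "\<phi> (a * b) = \<phi> a * \<phi> b"
    and \<phi>_1: "\<phi> 1 = 1"
    and \<phi>_commute: "\<phi> a * x = x * \<phi> a"
begin

lemma \<phi>_of_real: "\<phi> (of_real r) = r *\<^sub>R 1"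
  using linear_scale[OF bounded_linear.linear[OF bounded_linear_\<phi>], of r 1]
  by (simp add: \<phi>_1 of_real_def)

lemma power_\<phi>_mult: "(\<phi> a * x) ^ n = \<phi> (a ^ n) * x ^ n"
proof (induction n)
  case (Suc n)
  have comm: "\<phi> b * x = x * \<phi> b" for b by (rule \<phi>_commute)
  have "(\<phi> a * x) ^ Suc n = \<phi> a * (x * \<phi> (a ^ n)) * x ^ n"
    by (simp add: Suc mult.assoc)
  also have "\<dots> = \<phi> (a ^ Suc n) * x ^ Suc n"
    by (simp add: comm[symmetric] \<phi>_mult mult.assoc)
  finally show ?case .
qed (simp add: \<phi>_1)

lemma two_sided_unit_\<phi>: "a \<noteq> 0 \<Longrightarrow> two_sided_unit (\<phi> a)"
  by (rule two_sided_unitI[of "\<phi> (inverse a)"]) (simp_all flip: \<phi>_mult add: \<phi>_1)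

text \<open>Pulling out the invertible factor \<open>\<phi> a\<close> moves the question from the
  outside of a disc, where a is large, to the disc of the reciprocals w = 1/a. There w = 0 is
  harmless and compactness is available.\<close>

lemma two_sided_unit_resolvent_iff:
  assumes "a \<noteq> 0"
  shows "two_sided_unit (\<phi> a - x) \<longleftrightarrow> two_sided_unit (1 - \<phi> (inverse a) * x)"
proof -
  have inv: "\<phi> a * \<phi> (inverse a) = 1" "\<phi> (inverse a) * \<phi> a = 1"
    using assms by (simp_all flip: \<phi>_mult add: \<phi>_1)
  have 1: "\<phi> a - x = \<phi> a * (1 - \<phi> (inverse a) * x)"
    using inv by (simp add: right_diff_distrib flip: mult.assoc)
  have 2: "1 - \<phi> (inverse a) * x = \<phi> (inverse a) * (\<phi> a - x)"
    using inv by (simp add: right_diff_distrib)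
  show ?thesis
    using two_sided_unit_mult[OF two_sided_unit_\<phi>[of a], of "1 - \<phi> (inverse a) * x"]
      two_sided_unit_mult[OF two_sided_unit_\<phi>[of "inverse a"], of "\<phi> a - x"] assms
    by (auto simp: 1[symmetric] 2[symmetric])
qed

text \<open>Rickart's averaging trick: multiplied by 1 - (t x)^n, the inverse for each root becomes
  a polynomial in x, and the mean over all roots removes every term except the constant one.\<close>

lemma average_inverses:
  assumes n: "n \<ge> 1"
    and h: "\<And>k. k < n \<Longrightarrow> h k * (1 - \<phi> (cis (2 * pi * real k / real n) * of_real t) * x) = 1"
  shows "((1 / real n) *\<^sub>R (\<Sum>k<n. h k)) * (1 - t ^ n *\<^sub>R x ^ n) = 1"
proof -
  interpret \<phi>: bounded_linear \<phi> by (rule bounded_linear_\<phi>)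
  define \<omega> where "\<omega> k = cis (2 * pi * real k / real n)" for k
  have "h k * (1 - t ^ n *\<^sub>R x ^ n) = (\<Sum>j<n. \<phi> (\<omega> k ^ j * of_real t ^ j) * x ^ j)" if "k < n" for k
  proof -
    define y where "y = \<phi> (\<omega> k * of_real t) * x"
    have "\<omega> k ^ n = 1"
      using n by (simp add: \<omega>_def cis_root_of_unity)
    \<comment> \<open>The root disappears in the n-th power, so one and the same factor 1 - (t x)^n
      serves for every \<open>k\<close>.\<close>
    then have "y ^ n = t ^ n *\<^sub>R x ^ n"
      by (simp add: y_def power_\<phi>_mult power_mult_distrib \<phi>_of_real flip: of_real_power)
    then have "1 - t ^ n *\<^sub>R x ^ n = (1 - y) * (\<Sum>j<n. y ^ j)"
      by (simp add: one_minus_mult_sum_power)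
    then have "h k * (1 - t ^ n *\<^sub>R x ^ n) = (h k * (1 - y)) * (\<Sum>j<n. y ^ j)"
      by (simp add: mult.assoc)
    also have "h k * (1 - y) = 1"
      using h[OF that] by (simp add: y_def \<omega>_def)
    finally show ?thesis
      by (simp add: y_def power_\<phi>_mult power_mult_distrib)
  qed
  then have "(\<Sum>k<n. h k) * (1 - t ^ n *\<^sub>R x ^ n)
      = (\<Sum>k<n. \<Sum>j<n. \<phi> (\<omega> k ^ j * of_real t ^ j) * x ^ j)"
    by (simp add: sum_distrib_right)
  also have "\<dots> = (\<Sum>j<n. \<phi> ((\<Sum>k<n. \<omega> k ^ j) * of_real t ^ j) * x ^ j)"
    by (subst sum.swap) (simp add: sum_distrib_right \<phi>.sum)
  also have "\<dots> = (\<Sum>j<n. if j = 0 then real n *\<^sub>R 1 else 0)"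
    using \<phi>_of_real[of "real n"]
    by (intro sum.cong) (auto simp: \<omega>_def sum_powers_root_of_unity \<phi>.zero)
  also have "\<dots> = real n *\<^sub>R 1"
    using n by simp
  finally show ?thesis
    using n by simp
qed

text \<open>The mean \<open>A s\<close> of the inverses on the circle of radius \<open>s\<close> is
  a left inverse of 1 - (s x)^n. Just inside the boundary that power is small for large n, so the
  mean is near 1. Uniform continuity carries this to radius \<open>\<tau>\<close> with an error that
  does not depend on n, which forces (\<open>\<tau>\<close> x)^n to be small as well.\<close>

lemma power_small_at_boundary:
  assumes \<tau>: "0 \<le> \<tau>"
    and units: "\<And>w. cmod w \<le> \<tau> \<Longrightarrow> two_sided_unit (1 - \<phi> w * x)"
    and small: "\<And>t. 0 \<le> t \<Longrightarrow> t < \<tau> \<Longrightarrow> (\<lambda>n. t ^ n * norm (x ^ n)) \<longlonglongrightarrow> 0"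
  shows "\<exists>n\<ge>1. \<tau> ^ n * norm (x ^ n) < 1"
proof (cases "\<tau> = 0")
  case True
  then show ?thesis by (intro exI[of _ 1]) simp
next
  case False
  with \<tau> have \<tau>: "\<tau> > 0" by simp
  interpret \<phi>: bounded_linear \<phi> by (rule bounded_linear_\<phi>)
  obtain F where F: "F w * (1 - \<phi> w * x) = 1" "(1 - \<phi> w * x) * F w = 1"
    if "w \<in> cball 0 \<tau>" for w
    using units unfolding two_sided_unit_def mem_cball_0 by metis
  have "continuous_on (cball 0 \<tau>) (\<lambda>w. 1 - \<phi> w * x)"
    by (intro continuous_intros \<phi>.continuous_on)
  then have "continuous_on (cball 0 \<tau>) F"
    by (rule continuous_on_two_sided_inverse) (use F in auto)
  then have "uniformly_continuous_on (cball 0 \<tau>) F"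
    by (rule compact_uniformly_continuous) simp
  then obtain \<delta> where \<delta>: "\<delta> > 0"
    "\<And>v w. v \<in> cball 0 \<tau> \<Longrightarrow> w \<in> cball 0 \<tau> \<Longrightarrow> dist v w < \<delta> \<Longrightarrow> dist (F v) (F w) < 1 / 8"
    unfolding uniformly_continuous_on_def by (metis zero_less_divide_1_iff zero_less_numeral)
  \<comment> \<open>The radius \<open>t\<close> is fixed by \<open>\<delta>\<close> alone;
    \<open>n\<close> is chosen afterwards. The maximum with 0 keeps it a radius when
    \<open>\<delta>\<close> is large.\<close>
  define t where "t = max 0 (\<tau> - \<delta> / 2)"
  have t: "0 \<le> t" "t < \<tau>" "\<tau> - t < \<delta>"
    using \<tau> \<delta> by (auto simp: t_def)
  have "\<forall>\<^sub>F n in sequentially. t ^ n * norm (x ^ n) < 1 / 8 \<and> n \<ge> 1"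
    using order_tendstoD(2)[OF small[OF t(1,2)], of "1 / 8"] eventually_ge_at_top[of 1]
    by (auto intro: eventually_conj)
  then obtain n where n: "n \<ge> 1" "t ^ n * norm (x ^ n) < 1 / 8"
    by (auto simp: eventually_sequentially)
  define \<omega> where "\<omega> k = cis (2 * pi * real k / real n)" for k
  define A where "A s = (1 / real n) *\<^sub>R (\<Sum>k<n. F (\<omega> k * of_real s))" for s
  have A: "A s * (1 - s ^ n *\<^sub>R x ^ n) = 1" if "0 \<le> s" "s \<le> \<tau>" for s
    unfolding A_def \<omega>_def
    by (rule average_inverses) (use n F that in \<open>auto simp: norm_mult\<close>)
  \<comment> \<open>Each argument moves along a ray by \<open>\<tau> - t\<close>, so every summand
    changes by less than 1/8, and hence the mean by at most 1/8 whatever \<open>n\<close>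
    is.\<close>
  have "norm (A \<tau> - A t) \<le> 1 / 8"
  proof -
    have "norm (F (\<omega> k * of_real \<tau>) - F (\<omega> k * of_real t)) \<le> 1 / 8" for k
    proof -
      have "dist (\<omega> k * of_real \<tau>) (\<omega> k * of_real t) < \<delta>"
        using t by (simp add: dist_norm \<omega>_def norm_mult flip: right_diff_distrib of_real_diff)
      then have "dist (F (\<omega> k * of_real \<tau>)) (F (\<omega> k * of_real t)) < 1 / 8"
        using t \<tau> by (intro \<delta>(2)) (auto simp: \<omega>_def norm_mult)
      then show ?thesis by (simp add: dist_norm)
    qed
    then have "norm (\<Sum>k<n. F (\<omega> k * of_real \<tau>) - F (\<omega> k * of_real t)) \<le> real n * (1 / 8)"
      using sum_norm_bound[of "{..<n}" "\<lambda>k. F (\<omega> k * of_real \<tau>) - F (\<omega> k * of_real t)" "1 / 8"]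
      by simp
    then have "(1 / real n) * norm (\<Sum>k<n. F (\<omega> k * of_real \<tau>) - F (\<omega> k * of_real t)) \<le> 1 / 8"
      using n by (simp add: field_simps)
    also have "(1 / real n) * norm (\<Sum>k<n. F (\<omega> k * of_real \<tau>) - F (\<omega> k * of_real t)) = norm (A \<tau> - A t)"
      by (simp add: A_def sum_subtractf flip: scaleR_diff_right)
    finally show ?thesis .
  qed
  moreover have "norm (A t - 1) \<le> 1 / 7"
  proof -
    define y where "y = t ^ n *\<^sub>R x ^ n"
    have y: "norm y \<le> 1 / 8"
      using n t by (simp add: y_def)
    \<comment> \<open>This is \<open>A t * (1 - y) = 1\<close> rearranged. With e the norm of
      \<open>A t - 1\<close> it yields e <= 1/8 + e/8, hence the bound 1/7.\<close>
    have "A t - 1 = y + (A t - 1) * y"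
      using A[of t] t by (simp add: y_def algebra_simps)
    then have "norm (A t - 1) = norm (y + (A t - 1) * y)"
      by (rule arg_cong)
    also have "\<dots> \<le> norm y + norm ((A t - 1) * y)"
      by (rule norm_triangle_ineq)
    also have "\<dots> \<le> norm y + norm (A t - 1) * norm y"
      by (intro add_left_mono norm_mult_ineq)
    also have "\<dots> \<le> 1 / 8 + norm (A t - 1) * (1 / 8)"
      using y by (intro add_mono mult_left_mono) auto
    finally show ?thesis by simp
  qed
  ultimately have D: "norm (A \<tau> - 1) \<le> 2 / 7"
    using norm_triangle_ineq[of "A \<tau> - A t" "A t - 1"] by simp
  define y where "y = \<tau> ^ n *\<^sub>R x ^ n"
  \<comment> \<open>The same equation, now solved for \<open>y\<close>: since 1/8 + 1/7 <= 2/7, the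
    norm of \<open>y\<close> is at most 2/7 + 2/7 of itself, hence at most 2/5.\<close>
  have "y = (A \<tau> - 1) - (A \<tau> - 1) * y"
    using A[of \<tau>] \<tau> by (simp add: y_def algebra_simps)
  then have "norm y = norm ((A \<tau> - 1) - (A \<tau> - 1) * y)"
    by (rule arg_cong)
  also have "\<dots> \<le> norm (A \<tau> - 1) + norm ((A \<tau> - 1) * y)"
    by (rule norm_triangle_ineq4)
  also have "\<dots> \<le> norm (A \<tau> - 1) + norm (A \<tau> - 1) * norm y"
    by (intro add_left_mono norm_mult_ineq)
  also have "\<dots> \<le> 2 / 7 + (2 / 7) * norm y"
    using D by (intro add_mono mult_right_mono) auto
  finally have "norm y < 1" by simp
  then show ?thesis
    using n \<tau> by (auto simp: y_def)
qed

text \<open>At radius \<open>s\<close> the powers are summable by the geometric bound; a smaller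
  radius is dominated by \<open>s\<close>.\<close>

lemma scaled_powers_tendsto_0:
  assumes "s ^ n * norm (x ^ n) < 1" "n \<ge> 1" "0 \<le> t" "t \<le> s"
  shows "(\<lambda>m. t ^ m * norm (x ^ m)) \<longlonglongrightarrow> 0"
proof -
  have "(s *\<^sub>R x) ^ m = s ^ m *\<^sub>R x ^ m" for m
    by (induction m) (simp_all add: mult_ac)
  then have "summable (\<lambda>m. norm (s ^ m *\<^sub>R x ^ m))"
    using summable_norm_power[of "s *\<^sub>R x" n] assms by simp
  from summable_LIMSEQ_zero[OF this]
  have lim: "(\<lambda>m. s ^ m * norm (x ^ m)) \<longlonglongrightarrow> 0"
    using assms by simp
  show ?thesis
    by (rule real_tendsto_sandwich[OF _ _ tendsto_const lim])
       (use assms in \<open>auto intro!: always_eventually mult_right_mono power_mono\<close>)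
qed

text \<open>The deep half of Gelfand's formula. The radii at which some scaled power is a strict
  contraction form a set that contains its supremum, by the boundary lemma, and that can be extended
  to the right below 1/s. Hence it reaches 1/s.\<close>

theorem norm_power_eventually_less:
  assumes s: "s > 0" and units: "\<And>a. s \<le> cmod a \<Longrightarrow> two_sided_unit (\<phi> a - x)"
  shows "\<forall>\<^sub>F n in sequentially. norm (x ^ n) < s ^ n"
proof -
  interpret \<phi>: bounded_linear \<phi> by (rule bounded_linear_\<phi>)
  define u where "u = inverse s"
  have u: "u > 0" using s by (simp add: u_def)
  have units': "two_sided_unit (1 - \<phi> w * x)" if "cmod w \<le> u" for w
  proof (cases "w = 0")
    case False
    then have "s \<le> cmod (inverse w)"
      using that s by (simp add: u_def norm_divide field_simps)
    then show ?thesis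
      using two_sided_unit_resolvent_iff[of "inverse w"] units False by simp
  qed (simp add: \<phi>.zero)
  define S where "S = {t \<in> {0..u}. \<exists>n\<ge>1. t ^ n * norm (x ^ n) < 1}"
  have S0: "0 \<in> S"
    using u by (auto simp: S_def intro: exI[of _ 1])
  have bdd: "bdd_above S"
    by (rule bdd_aboveI[of _ u]) (auto simp: S_def)
  define \<tau> where "\<tau> = Sup S"
  have \<tau>: "0 \<le> \<tau>" "\<tau> \<le> u"
    using S0 bdd by (auto simp: \<tau>_def S_def intro!: cSup_upper cSup_least)
  \<comment> \<open>The supremum is attained: every smaller radius lies below a member of
    \<open>S\<close>, so the scaled powers tend to 0 there.\<close>
  have "\<exists>n\<ge>1. \<tau> ^ n * norm (x ^ n) < 1"
  proof (rule power_small_at_boundary)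
    fix t assume t: "0 \<le> t" "t < \<tau>"
    then obtain s where "s \<in> S" "t < s"
      using less_cSup_iff[OF _ bdd, of t] S0 by (auto simp: \<tau>_def)
    then show "(\<lambda>n. t ^ n * norm (x ^ n)) \<longlonglongrightarrow> 0"
      using t scaled_powers_tendsto_0[of s _ t] by (auto simp: S_def)
  qed (use \<tau> units' in auto)
  then obtain n where n: "n \<ge> 1" "\<tau> ^ n * norm (x ^ n) < 1" by blast
  have "\<tau> = u"
  proof (rule ccontr)
    assume "\<tau> \<noteq> u"
    then have "\<tau> < u" using \<tau> by simp
    \<comment> \<open>For this fixed \<open>n\<close> the strict inequality is an open condition on
      the radius, so it survives slightly to the right of \<open>\<tau>\<close>.\<close>
    have "((\<lambda>t. t ^ n * norm (x ^ n)) \<longlongrightarrow> \<tau> ^ n * norm (x ^ n)) (at_right \<tau>)"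
      by (intro tendsto_intros)
    then have "\<forall>\<^sub>F t in at_right \<tau>. t ^ n * norm (x ^ n) < 1"
      using n(2) by (rule order_tendstoD)
    moreover have "\<forall>\<^sub>F t in at_right \<tau>. t < u \<and> \<tau> < t"
      using \<open>\<tau> < u\<close> by (auto intro!: eventually_conj eventually_at_right_less
          simp: eventually_at_right[of _ u])
    ultimately have "\<forall>\<^sub>F t in at_right \<tau>. t ^ n * norm (x ^ n) < 1 \<and> t < u \<and> \<tau> < t"
      by eventually_elim simp
    then obtain t where t: "t ^ n * norm (x ^ n) < 1" "t < u" "\<tau> < t"
      using eventually_happens'[of "at_right \<tau>"] trivial_limit_at_right_real by blast
    then have "t \<in> S"
      using \<tau> n by (auto simp: S_def)
    then have "t \<le> \<tau>"
      unfolding \<tau>_def by (rule cSup_upper) (rule bdd)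
    with t show False by simp
  qed
  with n u have "(\<lambda>m. u ^ m * norm (x ^ m)) \<longlonglongrightarrow> 0"
    by (intro scaled_powers_tendsto_0[of u n]) auto
  then have "\<forall>\<^sub>F m in sequentially. u ^ m * norm (x ^ m) < 1"
    by (rule order_tendstoD) simp
  then show ?thesis
    by eventually_elim (use s in \<open>simp add: u_def field_simps\<close>)
qed

text \<open>The easy half of Gelfand's formula, by the Neumann series for x/a; contrapositively,
  |a|^n is at most the norm of \<open>x ^ n\<close> at every spectral value a.\<close>

theorem two_sided_unit_resolvent:
  assumes less: "norm (x ^ n) < cmod a ^ n" and "n \<ge> 1"
  shows "two_sided_unit (\<phi> a - x)"
proof -
  interpret \<phi>: bounded_linear \<phi> by (rule bounded_linear_\<phi>)
  obtain K where K: "K > 0" "\<And>b. norm (\<phi> b) \<le> norm b * K"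
    using \<phi>.pos_bounded by blast
  have "0 < cmod a ^ n"
    using less by (rule le_less_trans[rotated]) simp
  then have a: "a \<noteq> 0"
    using \<open>n \<ge> 1\<close> by (auto simp: power_0_left split: if_splits)
  define t where "t = inverse (cmod a)"
  have "(\<lambda>m. t ^ m * norm (x ^ m)) \<longlonglongrightarrow> 0"
    by (rule scaled_powers_tendsto_0[of t n]) (use assms a in \<open>auto simp: t_def field_simps\<close>)
  \<comment> \<open>The power \<open>n\<close> itself need not suffice, because
    \<open>\<phi>\<close> may enlarge norms by \<open>K\<close>. A later power is small enough to
    absorb this factor.\<close>
  then have "\<forall>\<^sub>F m in sequentially. t ^ m * norm (x ^ m) < 1 / K"
    by (rule order_tendstoD) (use K in auto)
  then have "\<forall>\<^sub>F m in sequentially. t ^ m * norm (x ^ m) < 1 / K \<and> m \<ge> 1"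
    using eventually_ge_at_top[of 1] by (rule eventually_conj)
  then obtain m where m: "m \<ge> 1" "t ^ m * norm (x ^ m) < 1 / K"
    by (auto simp: eventually_sequentially)
  have "norm ((\<phi> (inverse a) * x) ^ m) \<le> norm (\<phi> (inverse a ^ m)) * norm (x ^ m)"
    by (simp add: power_\<phi>_mult norm_mult_ineq)
  also have "\<dots> \<le> (t ^ m * K) * norm (x ^ m)"
    using K(2)[of "inverse a ^ m"]
    by (intro mult_right_mono) (auto simp: t_def norm_power norm_inverse)
  also have "\<dots> < 1"
    using m K by (simp add: field_simps)
  finally show ?thesis
    using two_sided_unit_one_minus[of "\<phi> (inverse a) * x" m] m
      two_sided_unit_resolvent_iff[OF a] by simp
qed

end

section \<open>Operators on the complexification\<close>

text \<open>
  The unit is supplied by \<^class>\<open>monoid_mult\<close> because \<^class>\<open>ring_1\<close> demands \<open>0 \<noteq> 1\<close>, which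
  fails for the trivial space.
\<close>

typedef (overloaded) ('a::real_normed_vector) endo = "UNIV :: ('a \<Rightarrow>\<^sub>L 'a) set"
  morphisms blinfun_of_endo Endo
  by simp

setup_lifting type_definition_endo

instantiation endo :: (real_normed_vector) "{real_normed_algebra, monoid_mult}"
begin

lift_definition zero_endo :: "'a endo" is 0 .
lift_definition one_endo :: "'a endo" is id_blinfun .
lift_definition plus_endo :: "'a endo \<Rightarrow> 'a endo \<Rightarrow> 'a endo" is "(+)" .
lift_definition minus_endo :: "'a endo \<Rightarrow> 'a endo \<Rightarrow> 'a endo" is "(-)" .
lift_definition uminus_endo :: "'a endo \<Rightarrow> 'a endo" is uminus .
lift_definition times_endo :: "'a endo \<Rightarrow> 'a endo \<Rightarrow> 'a endo" is "(o\<^sub>L)" .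
lift_definition scaleR_endo :: "real \<Rightarrow> 'a endo \<Rightarrow> 'a endo" is "(*\<^sub>R)" .
lift_definition norm_endo :: "'a endo \<Rightarrow> real" is norm .

definition sgn_endo :: "'a endo \<Rightarrow> 'a endo" where
  "sgn_endo a = inverse (norm a) *\<^sub>R a"

definition dist_endo :: "'a endo \<Rightarrow> 'a endo \<Rightarrow> real" where
  "dist_endo a b = norm (a - b)"

definition uniformity_endo :: "('a endo \<times> 'a endo) filter" where
  "uniformity_endo = (INF e\<in>{0<..}. principal {(a, b). dist a b < e})"

definition open_endo :: "'a endo set \<Rightarrow> bool" where
  "open_endo U \<longleftrightarrow> (\<forall>a\<in>U. \<forall>\<^sub>F (a', b) in uniformity. a' = a \<longrightarrow> b \<in> U)"

instance
proof
  fix a b c :: "'a endo" and r s :: real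
  show "a + b + c = a + (b + c)" "a + b = b + a" "0 + a = a" "- a + a = 0" "a - b = a + - b"
    "r *\<^sub>R (a + b) = r *\<^sub>R a + r *\<^sub>R b" "(r + s) *\<^sub>R a = r *\<^sub>R a + s *\<^sub>R a"
    "r *\<^sub>R s *\<^sub>R a = (r * s) *\<^sub>R a" "1 *\<^sub>R a = a"
    "norm a = 0 \<longleftrightarrow> a = 0" "norm (a + b) \<le> norm a + norm b" "norm (r *\<^sub>R a) = \<bar>r\<bar> * norm a"
    by (transfer, simp add: algebra_simps norm_triangle_ineq)+
  show "a * b * c = a * (b * c)" "1 * a = a" "a * 1 = a"
    by (transfer, rule blinfun_eqI, simp)+
  show "(a + b) * c = a * c + b * c" "a * (b + c) = a * b + a * c"
    "r *\<^sub>R a * b = r *\<^sub>R (a * b)" "a * r *\<^sub>R b = r *\<^sub>R (a * b)"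
    by (transfer, rule blinfun_eqI, simp add: blinfun.bilinear_simps)+
  show "norm (a * b) \<le> norm a * norm b"
    by transfer (rule norm_blinfun_compose)
qed (simp_all add: sgn_endo_def dist_endo_def uniformity_endo_def open_endo_def)

end

instance endo :: (banach) banach
proof
  fix X :: "nat \<Rightarrow> 'a endo"
  assume "Cauchy X"
  then have "Cauchy (\<lambda>n. blinfun_of_endo (X n))"
    by (simp add: Cauchy_def dist_norm norm_endo.rep_eq minus_endo.rep_eq)
  then obtain L where "(\<lambda>n. blinfun_of_endo (X n)) \<longlonglongrightarrow> L"
    by (auto simp: Cauchy_convergent_iff convergent_def)
  then have "X \<longlonglongrightarrow> Endo L"
    by (simp add: lim_sequentially dist_norm norm_endo.rep_eq minus_endo.rep_eq Endo_inverse)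
  then show "convergent X"
    by (auto simp: convergent_def)
qed

section \<open>Operators as algebra elements, and continuous inverses\<close>

definition endo_apply :: "'a::real_normed_vector endo \<Rightarrow> 'a \<Rightarrow> 'a" where
  "endo_apply a = blinfun_apply (blinfun_of_endo a)"

definition endo_of :: "('a::real_normed_vector \<Rightarrow> 'a) \<Rightarrow> 'a endo" where
  "endo_of g = Endo (Blinfun g)"

lemma endo_apply_endo_of [simp]: "bounded_linear g \<Longrightarrow> endo_apply (endo_of g) = g"
  by (simp add: endo_apply_def endo_of_def Endo_inverse bounded_linear_Blinfun_apply)

lemma endo_eqI: "(\<And>z. endo_apply a z = endo_apply b z) \<Longrightarrow> a = b"
  unfolding endo_apply_def by (simp add: blinfun_eqI flip: blinfun_of_endo_inject)

lemma bounded_linear_endo_apply: "bounded_linear (endo_apply a)"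
  unfolding endo_apply_def by (rule blinfun.bounded_linear_right)

lemma endo_apply_simps [simp]:
  "endo_apply 0 z = 0"
  "endo_apply 1 z = z"
  "endo_apply (a + b) z = endo_apply a z + endo_apply b z"
  "endo_apply (a - b) z = endo_apply a z - endo_apply b z"
  "endo_apply (a * b) z = endo_apply a (endo_apply b z)"
  "endo_apply (r *\<^sub>R a) z = r *\<^sub>R endo_apply a z"
  by (simp_all add: endo_apply_def zero_endo.rep_eq one_endo.rep_eq plus_endo.rep_eq
      minus_endo.rep_eq times_endo.rep_eq scaleR_endo.rep_eq blinfun.bilinear_simps)

lemma norm_endo: "norm a = onorm (endo_apply a)"
  by (simp add: endo_apply_def norm_endo.rep_eq norm_blinfun.rep_eq)

lemma bounded_linear_of_continuous:
  fixes g :: "'a::real_normed_vector \<Rightarrow> 'b::real_normed_vector"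
  assumes "linear g" "continuous_on UNIV g"
  shows "bounded_linear g"
proof -
  interpret linear g by fact
  have "isCont g 0"
    using assms(2) by (simp add: continuous_on_eq_continuous_at)
  then obtain d where d: "d > 0" "\<And>x. norm x < d \<Longrightarrow> norm (g x) < 1"
    unfolding continuous_at_eps_delta by (auto simp: zero dist_norm dest: spec[of _ 1])
  have "norm (g x) \<le> norm x * (2 / d)" for x
  proof (cases "x = 0")
    case False
    \<comment> \<open>The rescaled vector has norm d/2, so it lies in the ball that \<open>g\<close>
      maps into the unit ball.\<close>
    have "norm (g ((d / (2 * norm x)) *\<^sub>R x)) < 1"
      using d False by (intro d(2)) auto
    then show ?thesis
      using d False by (simp add: scale field_simps)
  qed (simp add: zero)
  then show ?thesis
    by (intro bounded_linear_intro add scale)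
qed

text \<open>The bridge from the topological definition of the spectrum to the algebra: the inverse
  of a linear bijection is linear, and continuity makes it bounded, hence an element of the
  algebra.\<close>

lemma two_sided_unit_endo_iff:
  "two_sided_unit a \<longleftrightarrow> has_continuous_inverse (endo_apply a)"
proof
  assume "two_sided_unit a"
  then obtain b where b: "b * a = 1" "a * b = 1"
    by (auto simp: two_sided_unit_def)
  then have *: "endo_apply b (endo_apply a z) = z" "endo_apply a (endo_apply b z) = z" for z
    by (metis endo_apply_simps(2,5))+
  then have "bij (endo_apply a)"
    by (intro o_bij[of "endo_apply b"]) (auto simp: fun_eq_iff)
  moreover have "inv (endo_apply a) = endo_apply b"
    using * by (intro inv_equality) auto
  ultimately show "has_continuous_inverse (endo_apply a)"
    unfolding has_continuous_inverse_def
    using linear_continuous_on[OF bounded_linear_endo_apply] by auto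
next
  assume "has_continuous_inverse (endo_apply a)"
  then have bij: "bij (endo_apply a)" and cont: "continuous_on UNIV (inv (endo_apply a))"
    by (auto simp: has_continuous_inverse_def)
  interpret a: bounded_linear "endo_apply a" by (rule bounded_linear_endo_apply)
  have 1: "inv (endo_apply a) (endo_apply a z) = z" "endo_apply a (inv (endo_apply a) z) = z" for z
    using bij by (simp_all add: bij_is_inj bij_is_surj surj_f_inv_f)
  have "linear (inv (endo_apply a))"
    by (intro linearI; rule injD[OF bij_is_inj[OF bij]]) (simp_all add: 1 a.add a.scale)
  with cont have "bounded_linear (inv (endo_apply a))"
    by (intro bounded_linear_of_continuous)
  then show "two_sided_unit a"
    by (intro two_sided_unitI[of "endo_of (inv (endo_apply a))"]; intro endo_eqI) (simp_all add: 1)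
qed

section \<open>Norm estimates on the complexification\<close>

lemma complexification_simps [simp]:
  "re_part 0 = 0" "im_part 0 = 0"
  "re_part (z + w) = re_part z + re_part w" "im_part (z + w) = im_part z + im_part w"
  "re_part (z - w) = re_part z - re_part w" "im_part (z - w) = im_part z - im_part w"
  "re_part (r *\<^sub>R z) = r *\<^sub>R re_part z" "im_part (r *\<^sub>R z) = r *\<^sub>R im_part z"
  "re_part (scaleC c z) = Re c *\<^sub>R re_part z - Im c *\<^sub>R im_part z"
  "im_part (scaleC c z) = Re c *\<^sub>R im_part z + Im c *\<^sub>R re_part z"
  "re_part (complexify_op g z) = g (re_part z)" "im_part (complexify_op g z) = g (im_part z)"
  by (simp_all add: zero_complexification_def plus_complexification_def minus_complexification_def
      scaleR_complexification_def scaleC_def complexify_op_def)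

lemma complexification_eqI: "re_part z = re_part w \<Longrightarrow> im_part z = im_part w \<Longrightarrow> z = w"
  by (rule complexification.expand) simp

lemma norm_complexification_le: "norm z \<le> norm (re_part z) + norm (im_part z)"
  and norm_rotated_le_parts:
    "norm (cos t *\<^sub>R re_part z - sin t *\<^sub>R im_part z) \<le> norm (re_part z) + norm (im_part z)"
proof -
  show le: "norm (cos t *\<^sub>R re_part z - sin t *\<^sub>R im_part z) \<le> norm (re_part z) + norm (im_part z)" for t
  proof -
    have "norm (cos t *\<^sub>R re_part z - sin t *\<^sub>R im_part z)
        \<le> norm (cos t *\<^sub>R re_part z) + norm (sin t *\<^sub>R im_part z)"
      by (rule norm_triangle_ineq4)
    also have "\<dots> \<le> norm (re_part z) + norm (im_part z)"
      by (simp add: add_mono mult_left_le_one_le)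
    finally show ?thesis .
  qed
  show "norm z \<le> norm (re_part z) + norm (im_part z)"
    unfolding norm_complexification_def by (intro cSUP_least le) auto
qed

lemma norm_rotated_le:
  assumes "t \<in> {0..2 * pi}"
  shows "norm (cos t *\<^sub>R re_part z - sin t *\<^sub>R im_part z) \<le> norm z"
  unfolding norm_complexification_def
  using assms norm_rotated_le_parts by (intro cSUP_upper bdd_aboveI2)

lemma norm_re_part_le: "norm (re_part z) \<le> norm z"
  and norm_im_part_le: "norm (im_part z) \<le> norm z"
  \<comment> \<open>The angle 0 isolates the real part, and the angle pi/2 isolates the imaginary
    part up to sign.\<close>
  using norm_rotated_le[of 0 z] norm_rotated_le[of "pi / 2" z] by simp_all

lemma norm_Complexify_0: "norm (Complexify v 0) = norm v"
  using norm_complexification_le[of "Complexify v 0"] norm_re_part_le[of "Complexify v 0"] by simp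

instance complexification :: (banach) banach
proof
  fix X :: "nat \<Rightarrow> 'a complexification"
  assume X: "Cauchy X"
  have "bounded_linear re_part" "bounded_linear im_part"
    by (rule bounded_linear_intro[of _ 1]; simp add: norm_re_part_le norm_im_part_le)+
  then have "Cauchy (\<lambda>n. re_part (X n))" "Cauchy (\<lambda>n. im_part (X n))"
    using X bounded_linear.Cauchy by blast+
  then obtain u v where "(\<lambda>n. re_part (X n)) \<longlonglongrightarrow> u" "(\<lambda>n. im_part (X n)) \<longlonglongrightarrow> v"
    by (auto simp: Cauchy_convergent_iff convergent_def)
  then have "(\<lambda>n. norm (re_part (X n) - u) + norm (im_part (X n) - v)) \<longlonglongrightarrow> 0"
    by (auto intro!: tendsto_eq_intros)
  then have "(\<lambda>n. X n - Complexify u v) \<longlonglongrightarrow> 0"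
    by (rule Lim_null_comparison[rotated])
       (use norm_complexification_le[of "X _ - Complexify u v"] in \<open>auto intro!: always_eventually\<close>)
  then show "convergent X"
    using LIM_zero_cancel by (auto simp: convergent_def)
qed

text \<open>Each of the four products of a coefficient and a part is bounded by
  \<open>cmod c * norm z\<close>; this is the source of the constant 4.\<close>

lemma norm_scaleC_le: "norm (scaleC c z) \<le> 4 * cmod c * norm z"
proof -
  have 1: "norm (r *\<^sub>R re_part z) \<le> cmod c * norm z" "norm (r *\<^sub>R im_part z) \<le> cmod c * norm z"
    if "\<bar>r\<bar> \<le> cmod c" for r
    using that norm_re_part_le[of z] norm_im_part_le[of z] by (auto intro!: mult_mono)
  have "norm (scaleC c z) \<le> norm (Re c *\<^sub>R re_part z - Im c *\<^sub>R im_part z)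
      + norm (Re c *\<^sub>R im_part z + Im c *\<^sub>R re_part z)"
    using norm_complexification_le[of "scaleC c z"] by simp
  also have "\<dots> \<le> (norm (Re c *\<^sub>R re_part z) + norm (Im c *\<^sub>R im_part z))
      + (norm (Re c *\<^sub>R im_part z) + norm (Im c *\<^sub>R re_part z))"
    by (intro add_mono norm_triangle_ineq norm_triangle_ineq4)
  also have "\<dots> \<le> 4 * cmod c * norm z"
    using 1(1)[OF abs_Re_le_cmod] 1(2)[OF abs_Im_le_cmod]
      1(2)[OF abs_Re_le_cmod] 1(1)[OF abs_Im_le_cmod] by linarith
  finally show ?thesis .
qed

lemma bounded_linear_scaleC: "bounded_linear (scaleC c)"
  using norm_scaleC_le[of c]
  by (intro bounded_linear_intro[of _ "4 * cmod c"])
     (auto intro!: complexification_eqI simp: algebra_simps)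

text \<open>A real linear operator commutes with the rotations inside the supremum, so its operator
  norm bounds every term separately. This is where the choice of norm matters.\<close>

lemma norm_complexify_op_le:
  assumes "bounded_linear g"
  shows "norm (complexify_op g z) \<le> onorm g * norm z"
proof -
  interpret bounded_linear g by fact
  have "norm (cos t *\<^sub>R g (re_part z) - sin t *\<^sub>R g (im_part z)) \<le> onorm g * norm z"
    if "t \<in> {0..2 * pi}" for t
  proof -
    have "norm (g (cos t *\<^sub>R re_part z - sin t *\<^sub>R im_part z))
        \<le> onorm g * norm (cos t *\<^sub>R re_part z - sin t *\<^sub>R im_part z)"
      by (rule onorm[OF assms])
    also have "\<dots> \<le> onorm g * norm z"
      using that by (intro mult_left_mono norm_rotated_le onorm_pos_le assms)
    finally show ?thesis
      by (simp add: diff scale)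
  qed
  then show ?thesis
    unfolding norm_complexification_def[of "complexify_op g z"] by (intro cSUP_least) auto
qed

lemma bounded_linear_complexify_op:
  assumes "bounded_linear g"
  shows "bounded_linear (complexify_op g)"
proof -
  interpret bounded_linear g by fact
  show ?thesis
    by (rule bounded_linear_intro[of _ "onorm g"])
       (auto intro!: complexification_eqI simp: add scale norm_complexify_op_le assms mult.commute)
qed

text \<open>The lower bound comes from the isometric copy of the real space. Equality lets norms in
  the complex operator algebra be read as norms on the original space.\<close>

lemma onorm_complexify_op:
  assumes "bounded_linear g"
  shows "onorm (complexify_op g) = onorm g"
proof (rule antisym)
  show "onorm (complexify_op g) \<le> onorm g"
    by (intro onorm_bound norm_complexify_op_le onorm_pos_le assms)
  have "norm (g v) \<le> onorm (complexify_op g) * norm v" for v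
  proof -
    have "norm (g v) \<le> norm (complexify_op g (Complexify v 0))"
      using norm_re_part_le[of "complexify_op g (Complexify v 0)"] by simp
    also have "\<dots> \<le> onorm (complexify_op g) * norm v"
      using onorm[OF bounded_linear_complexify_op[OF assms], of "Complexify v 0"]
      by (simp add: norm_Complexify_0)
    finally show ?thesis .
  qed
  then show "onorm g \<le> onorm (complexify_op g)"
    by (intro onorm_bound onorm_pos_le bounded_linear_complexify_op assms)
qed

section \<open>Complex scalars and the spectrum in the operator algebra\<close>

definition scalar_endo :: "complex \<Rightarrow> 'a::real_normed_vector complexification endo" where
  "scalar_endo c = endo_of (scaleC c)"

definition complexify_endo :: "('a::real_normed_vector \<Rightarrow> 'a) \<Rightarrow> 'a complexification endo" where
  "complexify_endo g = endo_of (complexify_op g)"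

lemma endo_apply_scalar_endo [simp]: "endo_apply (scalar_endo c) = scaleC c"
  by (simp add: scalar_endo_def bounded_linear_scaleC)

lemma endo_apply_complexify_endo [simp]:
  "bounded_linear g \<Longrightarrow> endo_apply (complexify_endo g) = complexify_op g"
  by (simp add: complexify_endo_def bounded_linear_complexify_op)

lemma norm_complexify_endo: "bounded_linear g \<Longrightarrow> norm (complexify_endo g) = onorm g"
  by (simp add: norm_endo onorm_complexify_op)

lemma complex_scalars_complexify_endo:
  fixes g :: "'a::banach \<Rightarrow> 'a"
  assumes "bounded_linear g"
  shows "complex_scalars scalar_endo (complexify_endo g)"
proof
  interpret bounded_linear g by fact
  fix a b :: complex and r :: real
  show "scalar_endo (a + b) = scalar_endo a + (scalar_endo b :: 'a complexification endo)"
    "scalar_endo (r *\<^sub>R a) = r *\<^sub>R (scalar_endo a :: 'a complexification endo)"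
    "scalar_endo (a * b) = scalar_endo a * (scalar_endo b :: 'a complexification endo)"
    "scalar_endo 1 = (1 :: 'a complexification endo)"
    "scalar_endo a * complexify_endo g = complexify_endo g * scalar_endo a"
    by (auto intro!: endo_eqI complexification_eqI simp: assms add diff scale algebra_simps)
  have "norm (scalar_endo c :: 'a complexification endo) \<le> norm c * 4" for c
    unfolding norm_endo using norm_scaleC_le[of c] by (intro onorm_bound) (auto simp: mult_ac)
  then show "\<exists>K. \<forall>c. norm (scalar_endo c :: 'a complexification endo) \<le> norm c * K"
    by blast
qed

lemma spectrum_iff_two_sided_unit:
  assumes "bounded_linear g"
  shows "c \<in> spectrum g \<longleftrightarrow> \<not> two_sided_unit (scalar_endo c - complexify_endo g)"
proof -
  have "endo_apply (scalar_endo c - complexify_endo g) = (\<lambda>z. scaleC c z - complexify_op g z)"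
    using assms by auto
  then show ?thesis
    by (simp add: spectrum_def two_sided_unit_endo_iff)
qed

section \<open>Uniform ergodicity\<close>

context complex_scalars
begin

text \<open>Because \<open>x * p = 0\<close>, the left-hand element factors as (a - x)(1 - p/a), and
  the second factor is invertible since p is idempotent and a is neither 0 nor 1.\<close>

lemma two_sided_unit_add_idempotent_iff:
  assumes p: "p * p = p" "x * p = 0" "\<And>c. \<phi> c * p = p * \<phi> c"
    and a: "a \<noteq> 0" "a \<noteq> 1"
  shows "two_sided_unit (\<phi> a - (x + p)) \<longleftrightarrow> two_sided_unit (\<phi> a - x)"
proof -
  interpret \<phi>: bounded_linear \<phi> by (rule bounded_linear_\<phi>)
  \<comment> \<open>The inverse of 1 - p/a is 1 + p/(a - 1): in both products the coefficient of
    \<open>p\<close> is c - b - bc, which vanishes for these values.\<close>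
  define b c where "b = inverse a" and "c = inverse (a - 1)"
  have pp: "\<phi> u * p * (\<phi> v * p) = \<phi> (u * v) * p" for u v
  proof -
    have "\<phi> u * p * (\<phi> v * p) = \<phi> u * (p * \<phi> v) * p"
      by (simp add: mult.assoc)
    also have "\<dots> = \<phi> u * \<phi> v * (p * p)"
      by (simp add: mult.assoc flip: p(3))
    finally show ?thesis
      by (simp add: p(1) \<phi>_mult)
  qed
  have bc: "c - b = b * c"
    using a by (simp add: b_def c_def field_simps)
  have "(1 - \<phi> b * p) * (1 + \<phi> c * p) = 1 + \<phi> (c - b - b * c) * p"
    "(1 + \<phi> c * p) * (1 - \<phi> b * p) = 1 + \<phi> (c - b - c * b) * p"
    by (simp_all add: distrib_left distrib_right left_diff_distrib right_diff_distrib pp \<phi>.diff)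
  then have "two_sided_unit (1 - \<phi> b * p)"
    using bc by (intro two_sided_unitI[of "1 + \<phi> c * p"]) (simp_all add: mult.commute \<phi>.zero)
  moreover have "(\<phi> a - x) * (1 - \<phi> b * p) = \<phi> a - (x + p)"
  proof -
    have "\<phi> a * (\<phi> b * p) = p"
      using a by (simp add: b_def flip: mult.assoc \<phi>_mult) (simp add: \<phi>_1)
    moreover have "x * (\<phi> b * p) = 0"
      using p(2) by (metis \<phi>_commute mult.assoc mult_zero_right)
    ultimately show ?thesis
      by (simp add: left_diff_distrib right_diff_distrib)
  qed
  ultimately show ?thesis
    using two_sided_unit_mult_right_iff by metis
qed

end

section \<open>Compatibility of complexification with sums, products and powers\<close>

lemma complexify_endo_add:
  assumes "bounded_linear g" "bounded_linear h"
  shows "complexify_endo (\<lambda>x. g x + h x) = complexify_endo g + complexify_endo h"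
  using assms by (intro endo_eqI complexification_eqI) (simp_all add: bounded_linear_add)

lemma complexify_endo_mult:
  assumes "bounded_linear g" "bounded_linear h"
  shows "complexify_endo (g \<circ> h) = complexify_endo g * complexify_endo h"
  using assms by (intro endo_eqI complexification_eqI)
    (simp_all add: comp_def bounded_linear_compose)

lemma bounded_linear_funpow:
  fixes g :: "'a::real_normed_vector \<Rightarrow> 'a"
  assumes "bounded_linear g"
  shows "bounded_linear (g ^^ n)"
proof (induction n)
  case (Suc n)
  then show ?case
    using bounded_linear_compose[OF assms Suc] by (simp add: comp_def)
qed (simp add: id_def bounded_linear_ident)

lemma complexify_endo_power:
  assumes "bounded_linear g"
  shows "complexify_endo (g ^^ n) = complexify_endo g ^ n"
proof (induction n)
  case 0
  show ?case
    by (intro endo_eqI complexification_eqI) (simp_all add: id_def bounded_linear_ident)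
next
  case (Suc n)
  show ?case
    unfolding funpow.simps(2) power_Suc Suc.IH[symmetric]
    by (rule complexify_endo_mult[OF assms bounded_linear_funpow[OF assms]])
qed

lemma complexify_endo_0: "complexify_endo (\<lambda>x. 0) = 0"
  by (intro endo_eqI complexification_eqI) simp_all

lemma root_onorm_tendsto_beta_star:
  fixes T P :: "'a::banach \<Rightarrow> 'a"
  assumes T: "bounded_linear T" and P: "bounded_linear P"
    and PP: "P \<circ> P = P" and TP: "T \<circ> P = P" and PT: "P \<circ> T = P"
    and lim: "uniformly_ergodic T P"
  shows "(\<lambda>n. root n (onorm (\<lambda>x. (T ^^ n) x - P x))) \<longlonglongrightarrow> beta_star T"
proof -
  interpret T: bounded_linear T by (rule T)
  interpret P: bounded_linear P by (rule P)
  define Q where "Q = (\<lambda>x. T x - P x)"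
  have Q: "bounded_linear Q"
    unfolding Q_def by (intro bounded_linear_sub T P)
  have eqs: "P (P x) = P x" "T (P x) = P x" "P (T x) = P x" for x
    using PP TP PT by (simp_all add: fun_eq_iff)
  have PTn: "P ((T ^^ n) x) = P x" for n x
    by (induction n) (simp_all add: eqs)
  \<comment> \<open>Mixed terms cancel because \<open>P\<close> absorbs \<open>T\<close>. At
    exponent 0 the left side is the identity but the right side is I - P, hence the
    restriction.\<close>
  have Qn: "Q ^^ n = (\<lambda>x. (T ^^ n) x - P x)" if "n \<ge> 1" for n
    using that
    by (induction n rule: dec_induct) (auto simp: fun_eq_iff Q_def T.diff P.diff eqs PTn)
  define q p where "q = complexify_endo Q" and "p = complexify_endo P"
  interpret q: complex_scalars scalar_endo q
    unfolding q_def by (rule complex_scalars_complexify_endo[OF Q])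
  interpret p: complex_scalars scalar_endo p
    unfolding p_def by (rule complex_scalars_complexify_endo[OF P])
  have norm_q: "norm (q ^ n) = onorm (\<lambda>x. (T ^^ n) x - P x)" if "n \<ge> 1" for n
    using norm_complexify_endo[OF bounded_linear_funpow[OF Q], of n] complexify_endo_power[OF Q, of n]
    by (simp add: q_def Qn[OF that])
  have "Q \<circ> P = (\<lambda>x. 0)"
    by (auto simp: Q_def fun_eq_iff eqs)
  then have qp: "q * p = 0" "p * p = p"
    using complexify_endo_mult[OF Q P] complexify_endo_mult[OF P P]
    by (simp_all add: q_def p_def PP complexify_endo_0)
  have "complexify_endo T = q + p"
    using complexify_endo_add[OF Q P] by (simp add: q_def p_def Q_def)
  then have spectrum_T: "c \<in> spectrum T \<longleftrightarrow> \<not> two_sided_unit (scalar_endo c - q)"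
    if "c \<noteq> 0" "c \<noteq> 1" for c
    using that qp p.\<phi>_commute
    by (simp add: spectrum_iff_two_sided_unit[OF T] q.two_sided_unit_add_idempotent_iff)

  have lim': "\<forall>\<^sub>F n in sequentially. onorm (\<lambda>x. (T ^^ n) x - P x) < 1"
    using lim unfolding uniformly_ergodic_def by (rule order_tendstoD) simp
  have "\<forall>\<^sub>F n in sequentially. norm (q ^ n) < 1 \<and> n \<ge> 1"
    using lim' eventually_ge_at_top[of 1] by eventually_elim (simp add: norm_q)
  then obtain m where m: "m \<ge> 1" "norm (q ^ m) < 1"
    by (auto simp: eventually_sequentially)
  \<comment> \<open>The value 1 is removed from the spectrum of \<open>T\<close> by the definition
    of \<open>beta_star\<close>, so for \<open>q\<close> it has to be excluded separately, by the
    contracting power.\<close>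
  have unit_1: "two_sided_unit (scalar_endo 1 - q)"
    by (rule q.two_sided_unit_resolvent[of m]) (use m in auto)

  define \<Lambda> where "\<Lambda> = cmod ` (spectrum T - {1})"
  have beta: "beta_star T = (if \<Lambda> = {} then 0 else Sup \<Lambda>)"
    by (simp add: beta_star_def \<Lambda>_def)
  \<comment> \<open>The easy half of Gelfand's formula bounds spectral values by every root, not
    only in the limit. The value 0 lies outside the comparison with \<open>q\<close> but satisfies
    the bound trivially.\<close>
  have lower: "cmod c \<le> root n (norm (q ^ n))" if "c \<in> spectrum T" "c \<noteq> 1" "n \<ge> 1" for c n
  proof (cases "c = 0")
    case False
    then have "\<not> norm (q ^ n) < cmod c ^ n"
      using that spectrum_T q.two_sided_unit_resolvent by blast
    then have "root n (cmod c ^ n) \<le> root n (norm (q ^ n))"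
      using that by (intro real_root_le_mono) auto
    then show ?thesis
      using that by (simp add: real_root_power_cancel)
  qed (use that in simp)
  then have bdd: "bdd_above \<Lambda>"
    by (intro bdd_aboveI[of _ "root 1 (norm (q ^ 1))"]) (use lower[of _ 1] in \<open>auto simp: \<Lambda>_def\<close>)
  \<comment> \<open>For an empty set of moduli this is the convention that the supremum is
    0.\<close>
  have beta_nonneg: "beta_star T \<ge> 0"
    using bdd by (auto simp: beta \<Lambda>_def intro!: cSup_upper2)
  have beta_le: "beta_star T \<le> root n (norm (q ^ n))" if "n \<ge> 1" for n
    using lower that by (auto simp: beta \<Lambda>_def intro!: cSup_least)
  have upper: "\<forall>\<^sub>F n in sequentially. root n (norm (q ^ n)) < s" if s: "beta_star T < s" for s
  proof -
    have "s > 0" using beta_nonneg s by simp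
    \<comment> \<open>Outside radius \<open>s\<close> only the point 1 can belong to the spectrum of
      \<open>T\<close>, and it was treated above. The value 0 is excluded by
      \<open>s > 0\<close>.\<close>
    moreover have "two_sided_unit (scalar_endo c - q)" if c: "s \<le> cmod c" for c
    proof (cases "c = 1")
      case False
      have "c \<notin> spectrum T"
      proof
        assume "c \<in> spectrum T"
        with False have "cmod c \<in> \<Lambda>" by (auto simp: \<Lambda>_def)
        then have "cmod c \<le> beta_star T"
          using bdd by (auto simp: beta intro: cSup_upper)
        with s c show False by simp
      qed
      then show ?thesis
        using spectrum_T[of c] False c \<open>s > 0\<close> by (cases "c = 0") simp_all
    qed (simp add: unit_1)
    ultimately have "\<forall>\<^sub>F n in sequentially. norm (q ^ n) < s ^ n"
      by (rule q.norm_power_eventually_less)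
    then show ?thesis
      using eventually_ge_at_top[of 1]
    proof eventually_elim
      case (elim n)
      then have "root n (norm (q ^ n)) < root n (s ^ n)"
        by (intro real_root_less_mono) auto
      then show ?case
        using elim \<open>s > 0\<close> by (simp add: real_root_power_cancel)
    qed
  qed
  have "(\<lambda>n. root n (norm (q ^ n))) \<longlonglongrightarrow> beta_star T"
  proof (rule order_tendstoI)
    fix s assume "s < beta_star T"
    show "\<forall>\<^sub>F n in sequentially. s < root n (norm (q ^ n))"
      using eventually_ge_at_top[of 1]
      by eventually_elim (use beta_le \<open>s < beta_star T\<close> in fastforce)
  qed (rule upper)
  then show ?thesis
    by (rule Lim_transform_eventually)
       (use norm_q in \<open>auto simp: eventually_sequentially intro!: exI[of _ 1]\<close>)
qed

section \<open>Markov operators are contractions for the base norm\<close>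

context abstract_state_space
begin

lemma obtain_base_element:
  obtains k where "\<And>y. 0 \<le> y \<Longrightarrow> k y \<in> base f" "\<And>y. 0 \<le> y \<Longrightarrow> y = f y *\<^sub>R k y"
proof -
  interpret linear f by (rule linear_functional)
  have normalised: "inverse (f y) *\<^sub>R y \<in> base f" "y = f y *\<^sub>R (inverse (f y) *\<^sub>R y)"
    if "0 \<le> y" "y \<noteq> 0" for y
    using that strictly_positive by (force simp: base_def scale intro!: scaleR_nonneg_nonneg)+
  obtain v :: 'a where "0 \<le> v" "v \<noteq> 0"
  proof -
    obtain x :: 'a where "x \<noteq> 0"
      using nontrivial by blast
    moreover obtain y z where "0 \<le> y" "0 \<le> z" "x = y - z"
      using generating by blast
    ultimately have "0 \<le> y \<and> y \<noteq> 0 \<or> 0 \<le> z \<and> z \<noteq> 0"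
      by auto
    then show ?thesis
      using that by blast
  qed
  then have "inverse (f v) *\<^sub>R v \<in> base f"
    by (rule normalised)
  then show ?thesis
    \<comment> \<open>At 0 any base element will do, because \<open>f 0 = 0\<close>; one exists
      since the space is nontrivial and the cone generating.\<close>
    using normalised that[of "\<lambda>y. if y = 0 then inverse (f v) *\<^sub>R v else inverse (f y) *\<^sub>R y"]
    by (auto simp: zero)
qed

text \<open>The convex hull absorbs every vector: normalising both parts of x = y - z writes x as
  \<open>f y + f z\<close> times a convex combination. This makes the infimum in
  \<open>base_norm\<close> one over a nonempty set.\<close>

lemma mem_scaled_hull:
  obtains c where "0 \<le> c" "x \<in> (\<lambda>u. c *\<^sub>R u) ` (convex hull (base f \<union> uminus ` base f))"
proof -
  define U where "U = convex hull (base f \<union> uminus ` base f)"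
  interpret linear f by (rule linear_functional)
  obtain k where k: "\<And>y. 0 \<le> y \<Longrightarrow> k y \<in> base f" "\<And>y. 0 \<le> y \<Longrightarrow> y = f y *\<^sub>R k y"
    by (rule obtain_base_element) blast
  obtain y z where yz: "0 \<le> y" "0 \<le> z" "x = y - z"
    using generating by blast
  have f_nonneg: "0 \<le> f y" "0 \<le> f z"
    using yz strictly_positive by (metis less_eq_real_def zero)+
  have mem: "k y \<in> U" "- k z \<in> U"
    using k(1)[OF yz(1)] k(1)[OF yz(2)] by (auto simp: U_def intro!: hull_inc)
  define c where "c = f y + f z"
  show ?thesis
  proof (cases "c = 0")
    case True
    then have "f y = 0" "f z = 0"
      using f_nonneg by (auto simp: c_def)
    then have "x = 0"
      using k(2)[OF yz(1)] k(2)[OF yz(2)] yz(3) by simp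
    then show ?thesis
      using that[of 0] mem by (auto simp: U_def)
  next
    case False
    with f_nonneg have c: "c > 0" by (auto simp: c_def)
    define u where "u = (f y / c) *\<^sub>R k y + (f z / c) *\<^sub>R (- k z)"
    have "u \<in> U"
      unfolding u_def
      by (rule convexD) (use mem c f_nonneg in \<open>auto simp: U_def c_def simp flip: add_divide_distrib\<close>)
    moreover have "x = c *\<^sub>R u"
      using c unfolding yz(3) by (subst k(2)[OF yz(1)], subst k(2)[OF yz(2)])
        (simp add: u_def scaleR_diff_right)
    ultimately show ?thesis
      using that[of c] c by (auto simp: U_def)
  qed
qed

text \<open>A Markov operator maps the hull into itself, so every factor admissible for
  \<open>x\<close> is admissible for \<open>T x\<close>, and the infimum over the larger set is no
  larger.\<close>

lemma norm_markov_operator_le: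
  assumes "markov_operator f T"
  shows "norm (T x) \<le> norm x"
proof -
  interpret T: linear T
    using assms by (simp add: markov_operator_def)
  define U where "U = convex hull (base f \<union> uminus ` base f)"
  have "T ` U = convex hull (T ` (base f \<union> uminus ` base f))"
    unfolding U_def by (rule convex_hull_linear_image) (rule T.linear_axioms)
  also have "\<dots> \<subseteq> U"
    unfolding U_def using assms
    by (intro hull_mono) (auto simp: markov_operator_def T.neg image_iff)
  finally have TU: "T ` U \<subseteq> U" .
  have "Inf {c. 0 \<le> c \<and> T x \<in> (\<lambda>u. c *\<^sub>R u) ` U} \<le> Inf {c. 0 \<le> c \<and> x \<in> (\<lambda>u. c *\<^sub>R u) ` U}"
  proof (rule cInf_superset_mono)
    obtain c where "0 \<le> c" "x \<in> (\<lambda>u. c *\<^sub>R u) ` U"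
      unfolding U_def by (rule mem_scaled_hull)
    then show "{c. 0 \<le> c \<and> x \<in> (\<lambda>u. c *\<^sub>R u) ` U} \<noteq> {}"
      by blast
    show "bdd_below {c. 0 \<le> c \<and> T x \<in> (\<lambda>u. c *\<^sub>R u) ` U}"
      by (rule bdd_belowI[of _ 0]) auto
    show "{c. 0 \<le> c \<and> x \<in> (\<lambda>u. c *\<^sub>R u) ` U} \<subseteq> {c. 0 \<le> c \<and> T x \<in> (\<lambda>u. c *\<^sub>R u) ` U}"
    proof safe
      fix c u assume "u \<in> U"
      then have "T u \<in> U" using TU by blast
      then show "T (c *\<^sub>R u) \<in> (\<lambda>u. c *\<^sub>R u) ` U"
        by (simp add: T.scale imageI)
    qed
  qed
  then show ?thesis
    by (simp add: norm_eq_base_norm base_norm_def U_def)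
qed

lemma bounded_linear_markov_operator:
  assumes "markov_operator f T"
  shows "bounded_linear T"
proof -
  interpret T: linear T
    using assms by (simp add: markov_operator_def)
  show ?thesis
    by (rule bounded_linear_intro[of _ 1])
       (simp_all add: T.add T.scale norm_markov_operator_le[OF assms])
qed

end

section \<open>Identities between an operator and the limit of its powers\<close>

lemma uniformly_ergodic_tendsto:
  assumes "bounded_linear T" "bounded_linear P" "uniformly_ergodic T P"
  shows "(\<lambda>n. (T ^^ n) x) \<longlonglongrightarrow> P x"
proof -
  have "norm ((T ^^ n) x - P x) \<le> onorm (\<lambda>x. (T ^^ n) x - P x) * norm x" for n
    using onorm[OF bounded_linear_sub[OF bounded_linear_funpow[OF assms(1), of n] assms(2)]] .
  moreover have "(\<lambda>n. onorm (\<lambda>x. (T ^^ n) x - P x) * norm x) \<longlonglongrightarrow> 0"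
    using assms(3) tendsto_mult_right[of _ 0 sequentially "norm x"]
    by (auto simp: uniformly_ergodic_def)
  ultimately have "(\<lambda>n. (T ^^ n) x - P x) \<longlonglongrightarrow> 0"
    by (rule Lim_null_comparison[OF always_eventually[OF allI]])
  then show ?thesis
    by (rule LIM_zero_cancel)
qed

text \<open>The shifted powers still converge to P x; taking one factor \<open>T\<close> out on the
  left or on the right computes the same limit as T (P x) or P (T x).\<close>

lemma uniformly_ergodic_commute:
  assumes "bounded_linear T" "bounded_linear P" "uniformly_ergodic T P"
  shows "T \<circ> P = P" "P \<circ> T = P"
proof -
  note lim = uniformly_ergodic_tendsto[OF assms]
  show "T \<circ> P = P"
  proof
    fix x
    have "(\<lambda>n. (T ^^ Suc n) x) \<longlonglongrightarrow> T (P x)"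
      using bounded_linear.tendsto[OF assms(1) lim[of x]] by simp
    then show "(T \<circ> P) x = P x"
      using LIMSEQ_Suc[OF lim[of x]] LIMSEQ_unique by fastforce
  qed
  show "P \<circ> T = P"
  proof
    fix x
    have "(\<lambda>n. (T ^^ Suc n) x) \<longlonglongrightarrow> P (T x)"
      using lim[of "T x"] by (simp add: funpow_swap1)
    then show "(P \<circ> T) x = P x"
      using LIMSEQ_Suc[OF lim[of x]] LIMSEQ_unique by fastforce
  qed
qed

theorem corollary3p9:
  fixes f :: "'a::{ordered_real_vector, banach} \<Rightarrow> real"
    and T P :: "'a \<Rightarrow> 'a"
  assumes "abstract_state_space f"
    and "markov_operator f T"
    and "bounded_linear P"
    and "P \<circ> P = P"
    and "uniformly_ergodic T P"
  shows "\<exists>\<alpha> :: nat \<Rightarrow> real. \<alpha> \<longlonglongrightarrow> 0 \<and>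
    (\<forall>n\<ge>1. onorm (\<lambda>x. (T ^^ n) x - P x) = (beta_star T + \<alpha> n) ^ n)"
proof -
  define r where "r n = onorm (\<lambda>x. (T ^^ n) x - P x)" for n
  have T: "bounded_linear T"
    using assms(1,2) by (rule abstract_state_space.bounded_linear_markov_operator)
  have "(\<lambda>n. root n (r n)) \<longlonglongrightarrow> beta_star T"
    unfolding r_def using uniformly_ergodic_commute[OF T assms(3,5)] T assms(3-5)
    by (intro root_onorm_tendsto_beta_star)
  then have "(\<lambda>n. root n (r n) - beta_star T) \<longlonglongrightarrow> 0"
    by (rule LIM_zero)
  \<comment> \<open>The error term is the n-th root minus \<open>beta_star T\<close>. Taking the
    root is undone by the n-th power since \<open>r n\<close> is nonnegative and \<open>n\<close>
    positive.\<close>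
  moreover have "r n = (beta_star T + (root n (r n) - beta_star T)) ^ n" if "n \<ge> 1" for n
    using that bounded_linear_sub[OF bounded_linear_funpow[OF T, of n] assms(3)]
    by (simp add: r_def onorm_pos_le)
  ultimately show ?thesis
    unfolding r_def by (intro exI[of _ "\<lambda>n. root n (r n) - beta_star T"]) (simp add: r_def)
qed

end
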